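(* Let $\mathbf{X}$ be a finite set of discrete random variables with finite state space (set of configurations) $\Omega$ and distribution $\pi$ on $\Omega$, and let $\mathfrak{G}$ be a permutation group acting on $\Omega$ (the group of approximate automorphisms; it is not required that $\pi$ be invariant under $\mathfrak{G}$). Let $\mathcal{M}_{\mathtt{B}}$ be an aperiodic and irreducible Markov chain on $\Omega$ with stationary distribution $\pi$, and let $\mathcal{M}_{\mathtt{S}}$ be the orbital Metropolis chain for $\pi$ and $\mathfrak{G}$. Then for every $\alpha$ with $0 < \alpha < 1$, the mixture of $\mathcal{M}_{\mathtt{B}}$ and $\mathcal{M}_{\mathtt{S}}$ with parameter $\alpha$ is aperiodic, irreducible, and has $\pi$ as its unique stationary distribution.
   Context: All Markov chains are time-homogeneous chains on the finite set $\Omega$, given by a kernel (transition matrix) $P(\mathbf{x}\to\mathbf{y})$; $P^t(\mathbf{x}\to\mathbf{y})$ denotes the probability of being in state $\mathbf{y}$ after $t$ steps when starting at $\mathbf{x}$. A chain is irreducible if for all $\mathbf{x},\mathbf{y}\in\Omega$ there is a $t$ with $P^t(\mathbf{x}\to\mathbf{y})>0$, and aperiodic if for all $\mathbf{x}\in\Omega$, $\gcd\{t\ge 1 \mid P^t(\mathbf{x}\to\mathbf{x})>0\}=1$. A permutation group $\mathfrak{G}$ acting on $\Omega$ is a set of bijections $\Omega\to\Omega$ forming a group under composition. For $\mathbf{x}\in\Omega$ and $\mathfrak{g}\in\mathfrak{G}$, $\mathbf{x}^{\mathfrak{g}}$ is the image of $\mathbf{x}$ under $\mathfrak{g}$, and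 $\mathbf{x}^{\mathfrak{G}}=\{\mathbf{x}^{\mathfrak{g}} \mid \mathfrak{g}\in\mathfrak{G}\}$ is the orbit of $\mathbf{x}$. Orbital Metropolis chain $\mathcal{M}_{\mathtt{S}}$ for $\pi$ and $\mathfrak{G}$: being in state $\mathbf{x}_t$, (1) select a state $\mathbf{y}$ uniformly at random from the orbit $\mathbf{x}_t^{\mathfrak{G}}$; (2) with probability $\min\{\pi(\mathbf{y})/\pi(\mathbf{x}_t),1\}$ let $\mathbf{x}_{t+1}=\mathbf{y}$; (3) otherwise let $\mathbf{x}_{t+1}=\mathbf{x}_t$. Equivalently, its kernel is $P_{\mathtt{S}}(\mathbf{x}\to\mathbf{y})=\frac{1}{|\mathbf{x}^{\mathfrak{G}}|}\min\{\pi(\mathbf{y})/\pi(\mathbf{x}),1\}$ if $\mathbf{y}\in\mathbf{x}^{\mathfrak{G}}$, $\mathbf{y}\neq\mathbf{x}$; $P_{\mathtt{S}}(\mathbf{x}\to\mathbf{y})=0$ if $\mathbf{y}\notin\mathbf{x}^{\mathfrak{G}}$; and $P_{\mathtt{S}}(\mathbf{x}\to\mathbf{x})=1-\sum_{\mathbf{y}\neq\mathbf{x}}P_{\mathtt{S}}(\mathbf{x}\to\mathbf{y})$. Mixture: if $P_{\mathtt{B}}$ and $P_{\mathtt{S}}$ are the kernels of $\mathcal{M}_{\mathtt{B}}$ and $\mathcal{M}_{\mathtt{S}}$ and $0<\alpha<1$, the mixture with parameter $\alpha$ is the Markov chain that in each iteration applies $P_{\mathtt{B}}$ with probability $\alpha$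 and $P_{\mathtt{S}}$ with probability $1-\alpha$, i.e. the chain with kernel $\alpha P_{\mathtt{B}}+(1-\alpha)P_{\mathtt{S}}$. *)

theory Defs
  imports "HOL-Probability.Probability" "HOL-Algebra.Bij"
begin

text \<open>
  A chain on a finite set \<open>S\<close> is given by its kernel \<open>K :: 'a \<Rightarrow> 'a pmf\<close>; the transition probability
  from \<open>x\<close> to \<open>y\<close> is \<open>pmf (K x) y\<close>. Values of \<open>K\<close> outside \<open>S\<close> are irrelevant.
\<close>

definition markov_chain_on :: "'a set \<Rightarrow> ('a \<Rightarrow> 'a pmf) \<Rightarrow> bool" where
  "markov_chain_on S K \<longleftrightarrow> (\<forall>x\<in>S. set_pmf (K x) \<subseteq> S)"

primrec step_pmf :: "('a \<Rightarrow> 'a pmf) \<Rightarrow> nat \<Rightarrow> 'a \<Rightarrow> 'a pmf" where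
  "step_pmf K 0 x = return_pmf x"
| "step_pmf K (Suc t) x = bind_pmf (step_pmf K t x) K"

definition irreducible_chain :: "'a set \<Rightarrow> ('a \<Rightarrow> 'a pmf) \<Rightarrow> bool" where
  "irreducible_chain S K \<longleftrightarrow> (\<forall>x\<in>S. \<forall>y\<in>S. \<exists>t. pmf (step_pmf K t x) y > 0)"

definition aperiodic_chain :: "'a set \<Rightarrow> ('a \<Rightarrow> 'a pmf) \<Rightarrow> bool" where
  "aperiodic_chain S K \<longleftrightarrow> (\<forall>x\<in>S. Gcd {t::nat. t \<ge> 1 \<and> pmf (step_pmf K t x) x > 0} = 1)"

definition stationary_on :: "'a set \<Rightarrow> ('a \<Rightarrow> 'a pmf) \<Rightarrow> 'a pmf \<Rightarrow> bool" where
  "stationary_on S K \<rho> \<longleftrightarrow> set_pmf \<rho> \<subseteq> S \<and> bind_pmf \<rho> K = \<rho>"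

definition perm_orbit :: "('a \<Rightarrow> 'a) set \<Rightarrow> 'a \<Rightarrow> 'a set" where
  "perm_orbit G x = {g x | g. g \<in> G}"

text \<open>
  If \<open>pmf \<pi> x = 0\<close>, the acceptance probability is 0 because of \<open>a / 0 = 0\<close>. This does not occur when
  \<open>\<pi>\<close> is stationary for an irreducible chain.
\<close>

definition orbital_metropolis :: "'a pmf \<Rightarrow> ('a \<Rightarrow> 'a) set \<Rightarrow> 'a \<Rightarrow> 'a pmf" where
  "orbital_metropolis \<pi> G x =
     do {
       y \<leftarrow> pmf_of_set (perm_orbit G x);
       accept \<leftarrow> bernoulli_pmf (min (pmf \<pi> y / pmf \<pi> x) 1);
       return_pmf (if accept then y else x)
     }"

definition mixture_chain :: "real \<Rightarrow> ('a \<Rightarrow> 'a pmf) \<Rightarrow> ('a \<Rightarrow> 'a pmf) \<Rightarrow> 'a \<Rightarrow> 'a pmf" where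
  "mixture_chain \<alpha> K L x =
     do {
       b \<leftarrow> bernoulli_pmf \<alpha>;
       if b then K x else L x
     }"

lemma perm_orbit_props:
  assumes "finite S" "subgroup G (BijGroup S)" "x \<in> S"
  shows "perm_orbit G x \<subseteq> S" "finite (perm_orbit G x)" "x \<in> perm_orbit G x"
proof -
  have G: "G \<subseteq> Bij S"
    using subgroup.subset[OF assms(2)] by (simp add: BijGroup_def)
  show sub: "perm_orbit G x \<subseteq> S"
    using G assms(3) by (auto simp: perm_orbit_def Bij_def bij_betw_def)
  show "finite (perm_orbit G x)"
    using sub assms(1) by (rule finite_subset)
  have "(\<lambda>x\<in>S. x) \<in> G"
    using subgroup.one_closed[OF assms(2)] by (simp add: BijGroup_def)
  moreover have "x = (\<lambda>x\<in>S. x) x"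
    using assms(3) by simp
  ultimately show "x \<in> perm_orbit G x"
    unfolding perm_orbit_def by blast
qed

lemma pmf_orbital_metropolis:
  assumes "finite S" "subgroup G (BijGroup S)" "x \<in> S" "y \<noteq> x"
  shows "pmf (orbital_metropolis \<pi> G x) y =
    (if y \<in> perm_orbit G x
     then 1 / real (card (perm_orbit G x)) * min (pmf \<pi> y / pmf \<pi> x) 1 else 0)"
proof -
  let ?O = "perm_orbit G x"
  let ?a = "\<lambda>z. min (pmf \<pi> z / pmf \<pi> x) 1"
  note O = perm_orbit_props[OF assms(1-3)]
  have ne: "?O \<noteq> {}" using O(3) by blast
  have inner: "pmf (bernoulli_pmf (?a z) \<bind> (\<lambda>b. return_pmf (if b then z else x))) y
      = (if z = y then ?a y else 0)" for z
    using assms(4) by (auto simp: pmf_bind)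
  have "pmf (orbital_metropolis \<pi> G x) y =
      (\<Sum>z\<in>?O. if z = y then ?a y else 0) / real (card ?O)"
    unfolding orbital_metropolis_def pmf_bind[of "pmf_of_set ?O"] inner
    by (rule integral_pmf_of_set[OF ne O(2)])
  then show ?thesis
    using O(2) by (simp add: sum.delta)
qed

lemma pmf_mixture_chain:
  assumes "0 < \<alpha>" "\<alpha> < 1"
  shows "pmf (mixture_chain \<alpha> K L x) y = \<alpha> * pmf (K x) y + (1 - \<alpha>) * pmf (L x) y"
  using assms by (simp add: mixture_chain_def pmf_bind)

lemma markov_chain_on_orbital_metropolis:
  assumes "finite S" "subgroup G (BijGroup S)"
  shows "markov_chain_on S (orbital_metropolis \<pi> G)"
  unfolding markov_chain_on_def
proof
  fix x assume x: "x \<in> S"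
  note O = perm_orbit_props[OF assms x]
  have "set_pmf (pmf_of_set (perm_orbit G x)) = perm_orbit G x"
    using O(2,3) by (intro set_pmf_of_set) auto
  then show "set_pmf (orbital_metropolis \<pi> G x) \<subseteq> S"
    using O(1) x by (auto simp: orbital_metropolis_def)
qed

lemma markov_chain_on_mixture:
  assumes "markov_chain_on S K" "markov_chain_on S L"
  shows "markov_chain_on S (mixture_chain \<alpha> K L)"
  using assms by (fastforce simp: markov_chain_on_def mixture_chain_def split: if_splits)

end

theory Submission
  imports Defs
begin

text \<open>
  The transitions of the base chain all occur in the mixture, so irreducibility and aperiodicity
  carry over. The orbital Metropolis chain satisfies detailed balance, because the states of
  an orbit share that orbit and hence propose each other with equal probability; so \<open>\<pi>\<close> is stationary
  for both components. Uniqueness holds for every irreducible chain: if \<open>c\<close> is the minimum of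
  \<open>\<rho> x / \<sigma> x\<close>, the invariant function \<open>\<rho> - c \<sigma>\<close> is nonnegative, and its zero set is
  nonempty and closed under predecessors.
\<close>

lemma set_pmf_step_pmf_mono:
  assumes "\<And>x. set_pmf (K x) \<subseteq> set_pmf (L x)"
  shows "set_pmf (step_pmf K t x) \<subseteq> set_pmf (step_pmf L t x)"
proof (induction t)
  case (Suc t)
  with assms show ?case by (auto intro!: UN_mono)
qed simp

lemma irreducible_chain_mono:
  assumes "\<And>x. set_pmf (K x) \<subseteq> set_pmf (L x)" "irreducible_chain S K"
  shows "irreducible_chain S L"
  using assms(2) set_pmf_step_pmf_mono[of K L, OF assms(1)]
  unfolding irreducible_chain_def pmf_positive_iff by blast

text \<open>Extra transitions can only add return times, and the gcd of a larger set divides the gcd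
  of a smaller one, hence divides 1.\<close>

lemma aperiodic_chain_mono:
  assumes "\<And>x. set_pmf (K x) \<subseteq> set_pmf (L x)" "aperiodic_chain S K"
  shows "aperiodic_chain S L"
  unfolding aperiodic_chain_def
proof
  fix x assume "x \<in> S"
  let ?T = "\<lambda>K. {t::nat. t \<ge> 1 \<and> pmf (step_pmf K t x) x > 0}"
  have "?T K \<subseteq> ?T L"
    using set_pmf_step_pmf_mono[of K L, OF assms(1)] by (auto simp: pmf_positive_iff)
  then have "Gcd (?T L) dvd Gcd (?T K)"
    by (intro Gcd_greatest Gcd_dvd) blast
  with assms(2) \<open>x \<in> S\<close> show "Gcd (?T L) = 1"
    by (simp add: aperiodic_chain_def)
qed

text \<open>Turns invariance into a finite linear system, so that uniqueness and detailed balance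
  become computations with sums.\<close>

lemma pmf_bind_finite:
  assumes "finite S" "set_pmf \<rho> \<subseteq> S"
  shows "pmf (bind_pmf \<rho> K) y = (\<Sum>x\<in>S. pmf \<rho> x * pmf (K x) y)"
  unfolding pmf_bind
  by (subst integral_measure_pmf_real[OF assms(1)]) (use assms(2) in \<open>auto simp: mult.commute\<close>)

lemma set_pmf_step_pmf_subset:
  assumes "markov_chain_on S K" "x \<in> S"
  shows "set_pmf (step_pmf K t x) \<subseteq> S"
  by (induction t) (use assms in \<open>auto simp: markov_chain_on_def\<close>)

text \<open>Invariance makes the support of \<open>\<rho>\<close> equal to the set of its one-step
  successors, so no path can leave it.\<close>

lemma stationary_support_closed:
  assumes "stationary_on S K \<rho>" "x \<in> set_pmf \<rho>"
  shows "set_pmf (step_pmf K t x) \<subseteq> set_pmf \<rho>"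
proof (induction t)
  case (Suc t)
  have "set_pmf \<rho> = (\<Union>z\<in>set_pmf \<rho>. set_pmf (K z))"
    using assms(1) unfolding stationary_on_def by (metis set_bind_pmf)
  with Suc show ?case by auto
qed (use assms(2) in auto)

lemma irreducible_stationary_support:
  assumes "irreducible_chain S K" "stationary_on S K \<rho>"
  shows "set_pmf \<rho> = S"
proof
  show sub: "set_pmf \<rho> \<subseteq> S" using assms(2) by (simp add: stationary_on_def)
  obtain x where x: "x \<in> set_pmf \<rho>" using set_pmf_not_empty by fast
  show "S \<subseteq> set_pmf \<rho>"
    using assms(1) x sub stationary_support_closed[OF assms(2) x]
    unfolding irreducible_chain_def pmf_positive_iff by blast
qed

lemma irreducible_stationary_unique:
  assumes fin: "finite S" and mc: "markov_chain_on S K" and irr: "irreducible_chain S K"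
    and \<rho>: "stationary_on S K \<rho>" and \<sigma>: "stationary_on S K \<sigma>"
  shows "\<rho> = \<sigma>"
proof -
  note supp = irreducible_stationary_support[OF irr \<rho>] irreducible_stationary_support[OF irr \<sigma>]
  have "S \<noteq> {}" using supp set_pmf_not_empty by metis
  then obtain x0 where x0: "x0 \<in> S"
      and min: "\<And>x. x \<in> S \<Longrightarrow> pmf \<rho> x0 / pmf \<sigma> x0 \<le> pmf \<rho> x / pmf \<sigma> x"
    using arg_min_if_finite[OF fin, of "\<lambda>x. pmf \<rho> x / pmf \<sigma> x"] by (meson not_le)
  \<comment> \<open>Both supports are all of \<open>S\<close>, so the ratios have nonzero
    denominators; \<open>c\<close> is the largest constant that keeps
    \<open>\<rho> - c \<sigma>\<close> nonnegative on \<open>S\<close>.\<close>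
  define c where "c = pmf \<rho> x0 / pmf \<sigma> x0"
  define f where "f x = pmf \<rho> x - c * pmf \<sigma> x" for x
  have pos: "pmf \<sigma> x > 0" if "x \<in> S" for x
    using that supp by (simp add: pmf_positive_iff)
  have nonneg: "f x \<ge> 0" if "x \<in> S" for x
    using min[OF that] pos[OF that] by (simp add: f_def c_def field_simps)
  \<comment> \<open>\<open>f\<close> is no distribution, so its invariance is expressed by sums and
    follows by linearity.\<close>
  have inv: "f y = (\<Sum>x\<in>S. f x * pmf (K x) y)" for y
  proof -
    have "pmf \<rho> y = (\<Sum>x\<in>S. pmf \<rho> x * pmf (K x) y)" "pmf \<sigma> y = (\<Sum>x\<in>S. pmf \<sigma> x * pmf (K x) y)"
      using pmf_bind_finite[OF fin, of \<rho> K y] pmf_bind_finite[OF fin, of \<sigma> K y] \<rho> \<sigma>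
      by (simp_all add: stationary_on_def)
    then show ?thesis
      by (simp add: f_def left_diff_distrib sum_subtractf sum_distrib_left mult.assoc)
  qed
  \<comment> \<open>By \<open>inv\<close>, \<open>f y\<close> is a sum of nonnegative terms, so each
    term vanishes; where the transition probability is positive, the factor \<open>f x\<close> must
    be 0.\<close>
  have pred: "f x = 0" if "f y = 0" "x \<in> S" "y \<in> set_pmf (K x)" for x y
  proof -
    have "\<forall>x\<in>S. f x * pmf (K x) y = 0"
      using inv[of y] that(1) nonneg fin by (subst sum_nonneg_eq_0_iff[symmetric]) auto
    with that(2,3) show ?thesis by (auto simp: set_pmf_iff)
  qed
  \<comment> \<open>The induction peels off the last step of a path and moves the zero from
    \<open>y\<close> back to the previous state, hence the generalisation over
    \<open>y\<close>.\<close>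
  have reach: "x \<in> S \<Longrightarrow> y \<in> set_pmf (step_pmf K t x) \<Longrightarrow> f y = 0 \<Longrightarrow> f x = 0" for t x y
  proof (induction t arbitrary: y)
    case (Suc t)
    then obtain z where z: "z \<in> set_pmf (step_pmf K t x)" "y \<in> set_pmf (K z)" by auto
    moreover have "z \<in> S" using set_pmf_step_pmf_subset[OF mc Suc.prems(1)] z(1) by blast
    ultimately show ?case using Suc pred by blast
  qed simp
  have "f x0 = 0" using pos[OF x0] by (simp add: f_def c_def)
  then have f0: "f x = 0" if "x \<in> S" for x
    using that irr x0 reach unfolding irreducible_chain_def pmf_positive_iff by blast
  \<comment> \<open>Comparing total masses fixes the factor: both sums are 1.\<close>
  have "(\<Sum>x\<in>S. pmf \<rho> x) = c * (\<Sum>x\<in>S. pmf \<sigma> x)"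
    using f0 by (simp add: f_def sum_distrib_left)
  then have "c = 1"
    using supp by (simp add: sum_pmf_eq_1[OF fin])
  show ?thesis
  proof (rule pmf_eqI)
    show "pmf \<rho> x = pmf \<sigma> x" for x
      using f0[of x] supp \<open>c = 1\<close>
        pmf_eq_0_set_pmf[of \<rho> x] pmf_eq_0_set_pmf[of \<sigma> x] by (cases "x \<in> S") (auto simp: f_def)
  qed
qed

text \<open>Balance replaces the inflow into \<open>y\<close> by the outflow from \<open>y\<close>,
  and row \<open>y\<close> of the kernel has mass 1 on \<open>S\<close>.\<close>

lemma detailed_balance_stationary:
  assumes fin: "finite S" and mc: "markov_chain_on S K" and supp: "set_pmf \<rho> \<subseteq> S"
    and bal: "\<And>x y. x \<in> S \<Longrightarrow> y \<in> S \<Longrightarrow> pmf \<rho> x * pmf (K x) y = pmf \<rho> y * pmf (K y) x"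
  shows "stationary_on S K \<rho>"
proof -
  have "pmf (bind_pmf \<rho> K) y = pmf \<rho> y" for y
  proof (cases "y \<in> S")
    case True
    have "pmf (bind_pmf \<rho> K) y = (\<Sum>x\<in>S. pmf \<rho> y * pmf (K y) x)"
      using bal True by (simp add: pmf_bind_finite[OF fin supp])
    also have "\<dots> = pmf \<rho> y"
      using sum_pmf_eq_1[OF fin] mc True
      by (simp add: sum_distrib_left[symmetric] markov_chain_on_def)
    finally show ?thesis .
  next
    case False
    then have "y \<notin> set_pmf (bind_pmf \<rho> K)" "y \<notin> set_pmf \<rho>"
      using mc supp by (auto simp: markov_chain_on_def)
    then show ?thesis by (metis pmf_eq_0_set_pmf)
  qed
  then show ?thesis using supp by (simp add: stationary_on_def pmf_eqI)
qed

text \<open>Closure of \<open>G\<close> under composition. The product in \<open>BijGroup S\<close>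
  is the restricted \<open>compose S\<close>, which agrees with ordinary composition at
  \<open>x\<close> since \<open>x \<in> S\<close>.\<close>

lemma perm_orbit_subset:
  assumes "subgroup G (BijGroup S)" "x \<in> S" "y \<in> perm_orbit G x"
  shows "perm_orbit G y \<subseteq> perm_orbit G x"
proof
  fix z assume "z \<in> perm_orbit G y"
  then obtain g h where gh: "g \<in> G" "h \<in> G" "y = g x" "z = h y"
    using assms(3) by (auto simp: perm_orbit_def)
  have "g \<in> Bij S" "h \<in> Bij S"
    using subgroup.subset[OF assms(1)] gh by (auto simp: BijGroup_def)
  then have "compose S h g \<in> G"
    using subgroup.m_closed[OF assms(1) gh(2,1)] by (simp add: BijGroup_def)
  moreover have "z = compose S h g x"
    using gh assms(2) by (simp add: compose_def)
  ultimately show "z \<in> perm_orbit G x"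
    unfolding perm_orbit_def by blast
qed

lemma perm_orbit_sym:
  assumes "subgroup G (BijGroup S)" "x \<in> S" "y \<in> perm_orbit G x"
  shows "x \<in> perm_orbit G y"
proof -
  obtain g where g: "g \<in> G" "y = g x" using assms(3) by (auto simp: perm_orbit_def)
  have B: "g \<in> Bij S" using subgroup.subset[OF assms(1)] g by (auto simp: BijGroup_def)
  have "(\<lambda>z\<in>S. (inv_into S g) z) \<in> G"
    using subgroup.m_inv_closed[OF assms(1) g(1)] by (simp add: inv_BijGroup[OF B])
  moreover have "x = (\<lambda>z\<in>S. (inv_into S g) z) y"
    using B g(2) assms(2) by (auto simp: Bij_def bij_betw_def)
  ultimately show ?thesis unfolding perm_orbit_def by blast
qed

lemma perm_orbit_eq:
  assumes "finite S" "subgroup G (BijGroup S)" "x \<in> S" "y \<in> perm_orbit G x"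
  shows "perm_orbit G y = perm_orbit G x"
proof -
  have "y \<in> S" using perm_orbit_props(1)[OF assms(1-3)] assms(4) by blast
  then show ?thesis
    using perm_orbit_subset[OF assms(2)] perm_orbit_sym[OF assms(2-4)] assms(3,4) by blast
qed

text \<open>Within an orbit both proposal probabilities are the reciprocal of the same orbit size,
  and the accepted flow is symmetric; across orbits both sides are 0.\<close>

lemma orbital_metropolis_detailed_balance:
  assumes "finite S" "subgroup G (BijGroup S)" "x \<in> S" "y \<in> S"
  shows "pmf \<pi> x * pmf (orbital_metropolis \<pi> G x) y = pmf \<pi> y * pmf (orbital_metropolis \<pi> G y) x"
proof (cases "y = x")
  case False
  \<comment> \<open>If \<open>pmf \<pi> u = 0\<close>, both sides are 0, so states without mass are
    covered too.\<close>
  have flow: "pmf \<pi> u * min (pmf \<pi> v / pmf \<pi> u) 1 = min (pmf \<pi> v) (pmf \<pi> u)" for u v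
    by (cases "pmf \<pi> u = 0") (auto simp: min_mult_distrib_left)
  have mem: "y \<in> perm_orbit G x \<longleftrightarrow> x \<in> perm_orbit G y"
    using perm_orbit_sym[OF assms(2)] assms(3,4) by blast
  show ?thesis
  proof (cases "y \<in> perm_orbit G x")
    case True
    have orb: "perm_orbit G y = perm_orbit G x" by (rule perm_orbit_eq[OF assms(1-3) True])
    show ?thesis
      using True mem flow[of x y] flow[of y x] False
      by (simp add: pmf_orbital_metropolis[OF assms(1-3)]
          pmf_orbital_metropolis[OF assms(1,2,4)] orb min.commute)
  next
    case no: False
    then show ?thesis
      using mem False by (simp add: pmf_orbital_metropolis[OF assms(1-3)]
          pmf_orbital_metropolis[OF assms(1,2,4)])
  qed
qed simp

lemma stationary_on_orbital_metropolis:
  assumes "finite S" "subgroup G (BijGroup S)" "set_pmf \<pi> \<subseteq> S"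
  shows "stationary_on S (orbital_metropolis \<pi> G) \<pi>"
  using assms(1) markov_chain_on_orbital_metropolis[OF assms(1,2)] assms(3)
    orbital_metropolis_detailed_balance[OF assms(1,2)]
  by (rule detailed_balance_stationary)

text \<open>The coin is independent of the current state, so it may be tossed first; either outcome
  then preserves \<open>\<rho>\<close>.\<close>

lemma stationary_on_mixture:
  assumes "stationary_on S K \<rho>" "stationary_on S L \<rho>"
  shows "stationary_on S (mixture_chain \<alpha> K L) \<rho>"
proof -
  have "bind_pmf \<rho> (mixture_chain \<alpha> K L) =
      bernoulli_pmf \<alpha> \<bind> (\<lambda>b. \<rho> \<bind> (\<lambda>x. if b then K x else L x))"
    unfolding mixture_chain_def by (rule bind_commute_pmf)
  also have "\<dots> = bernoulli_pmf \<alpha> \<bind> (\<lambda>b. \<rho>)"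
  proof (intro bind_pmf_cong refl)
    show "\<rho> \<bind> (\<lambda>x. if b then K x else L x) = \<rho>" for b
      using assms by (cases b) (simp_all add: stationary_on_def)
  qed
  finally show ?thesis using assms by (simp add: stationary_on_def)
qed

text \<open>With \<open>\<alpha> > 0\<close> the coin selects \<open>K\<close> with positive
  probability. This inclusion feeds both monotonicity lemmas.\<close>

lemma set_pmf_mixture_chain_left:
  assumes "0 < \<alpha>" "\<alpha> < 1"
  shows "set_pmf (K x) \<subseteq> set_pmf (mixture_chain \<alpha> K L x)"
  using assms by (auto simp: mixture_chain_def set_pmf_bernoulli)

theorem theorem4:
  fixes \<Omega> :: "'a set"
    and \<pi> :: "'a pmf"
    and G :: "('a \<Rightarrow> 'a) set"
    and P\<^sub>B :: "'a \<Rightarrow> 'a pmf"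
    and \<alpha> :: real
  assumes "finite \<Omega>"
    and "set_pmf \<pi> \<subseteq> \<Omega>"
    and "subgroup G (BijGroup \<Omega>)"
    and "markov_chain_on \<Omega> P\<^sub>B"
    and "aperiodic_chain \<Omega> P\<^sub>B"
    and "irreducible_chain \<Omega> P\<^sub>B"
    and "stationary_on \<Omega> P\<^sub>B \<pi>"
    and "0 < \<alpha>" and "\<alpha> < 1"
  shows "aperiodic_chain \<Omega> (mixture_chain \<alpha> P\<^sub>B (orbital_metropolis \<pi> G)) \<and>
    irreducible_chain \<Omega> (mixture_chain \<alpha> P\<^sub>B (orbital_metropolis \<pi> G)) \<and>
    stationary_on \<Omega> (mixture_chain \<alpha> P\<^sub>B (orbital_metropolis \<pi> G)) \<pi> \<and>
    (\<forall>\<rho>. stationary_on \<Omega> (mixture_chain \<alpha> P\<^sub>B (orbital_metropolis \<pi> G)) \<rho> \<longrightarrow> \<rho> = \<pi>)"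
proof -
  let ?M = "mixture_chain \<alpha> P\<^sub>B (orbital_metropolis \<pi> G)"
  have supp: "set_pmf (P\<^sub>B x) \<subseteq> set_pmf (?M x)" for x
    by (rule set_pmf_mixture_chain_left[OF assms(8,9)])
  have "markov_chain_on \<Omega> ?M"
    by (intro markov_chain_on_mixture markov_chain_on_orbital_metropolis assms)
  moreover have "irreducible_chain \<Omega> ?M"
    by (rule irreducible_chain_mono[of P\<^sub>B ?M, OF supp assms(6)])
  moreover have "stationary_on \<Omega> ?M \<pi>"
    by (intro stationary_on_mixture stationary_on_orbital_metropolis assms)
  moreover have "aperiodic_chain \<Omega> ?M"
    by (rule aperiodic_chain_mono[of P\<^sub>B ?M, OF supp assms(5)])
  ultimately show ?thesis
    using irreducible_stationary_unique[OF assms(1)] by blast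
qed

end
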